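(* Let $m,n\ge 1$ be integers, let $A$ be a finite $K_m$-free graph, and let $p_1,\dots,p_n$ be partial isomorphisms on $A$. Then there exist a finite $K_m$-free graph $B$ containing $A$ as an (induced) subgraph and automorphisms $f_1,\dots,f_n\in\mathrm{Aut}(B)$ such that $f_i$ extends $p_i$ for every $1\le i\le n$.
   Context: A graph is a set with a symmetric irreflexive binary relation $R$. $B\supset A$ means that $A$ is a substructure of $B$, i.e. an induced subgraph. A graph is $K_m$-free if the complete graph $K_m$ on $m$ vertices does not embed into it, i.e. there are no $a_1,\dots,a_m$ in it with $a_iRa_j$ for all $1\le i<j\le m$. A partial isomorphism on $A$ is an injective map $p$ from a subset $D(p)\subset A$ into $A$ such that for all $a,b\in D(p)$: $aRb\iff p(a)Rp(b)$. *)

theory Defs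
  imports "Graph_Theory.Digraph_Component" "Graph_Theory.Pair_Digraph"
begin

(* pair_graph is the library's predicate for a finite vertex set pverts G with a symmetric
   irreflexive relation parcs G on it; both arcs (u,v) and (v,u) are present for each edge. *)

definition K_free :: "nat \<Rightarrow> 'a pair_pre_digraph \<Rightarrow> bool" where
  "K_free m G \<longleftrightarrow>
     \<not> (\<exists>a :: nat \<Rightarrow> 'a. (\<forall>i\<in>{1..m}. a i \<in> pverts G) \<and>
          (\<forall>i\<in>{1..m}. \<forall>j\<in>{1..m}. i < j \<longrightarrow> (a i, a j) \<in> parcs G))"

definition partial_isomorphism :: "'a pair_pre_digraph \<Rightarrow> ('a \<rightharpoonup> 'a) \<Rightarrow> bool" where
  "partial_isomorphism G p \<longleftrightarrow>
     dom p \<subseteq> pverts G \<and> ran p \<subseteq> pverts G \<and> inj_on p (dom p) \<and>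
     (\<forall>a\<in>dom p. \<forall>b\<in>dom p. (a, b) \<in> parcs G \<longleftrightarrow> (the (p a), the (p b)) \<in> parcs G)"

(* Automorphisms are total HOL functions, of which only the values on pverts G matter. *)
definition graph_automorphism :: "'a pair_pre_digraph \<Rightarrow> ('a \<Rightarrow> 'a) \<Rightarrow> bool" where
  "graph_automorphism G f \<longleftrightarrow>
     bij_betw f (pverts G) (pverts G) \<and>
     (\<forall>a\<in>pverts G. \<forall>b\<in>pverts G. (a, b) \<in> parcs G \<longleftrightarrow> (f a, f b) \<in> parcs G)"

(* For injective h this is the isomorphic copy of G along h. Since the vertex type 'a of G may
   itself be finite, extensions of G are taken over 'a + nat, with G identified with its copy
   along Inl. *)
definition graph_image :: "('a \<Rightarrow> 'b) \<Rightarrow> 'a pair_pre_digraph \<Rightarrow> 'b pair_pre_digraph" where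
  "graph_image h G = \<lparr> pverts = h ` pverts G, parcs = map_prod h h ` parcs G \<rparr>"

end

theory Submission
  imports Defs
begin

text \<open>
  Both steps are valuation constructions in the style of Hubicka, Konecny and
  Nesetril. Ignoring cliques, the vertices of an extension are pairs \<open>(x, S)\<close> of a vertex of
  \<open>A\<close> and a set of vertices, where \<open>(x, S)\<close> and \<open>(y, T)\<close> are adjacent iff \<open>x \<noteq> y\<close> and exactly one
  of \<open>y \<in> S\<close>, \<open>x \<in> T\<close> holds. A partial isomorphism is first extended arbitrarily to a permutation
  of the vertices of \<open>A\<close>, which then acts on the pairs after a symmetric pattern of membership flips.

  Given such an extension \<open>B\<close>, pair each vertex \<open>x\<close> with all functions assigning to every \<open>m\<close>-clique
  of \<open>B\<close> through \<open>x\<close> one of \<open>m - 1\<close> colours, and demand of adjacent vertices that their colours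
  differ on each common clique. An \<open>m\<close>-clique would need \<open>m\<close> distinct colours on its own projection,
  so none is left. As \<open>A\<close> is \<open>K\<^sub>m\<close>-free, it meets every \<open>m\<close>-clique of \<open>B\<close> in fewer than \<open>m\<close> vertices,
  which can be coloured injectively: this lifts \<open>A\<close>. Automorphisms of \<open>B\<close> lift by permuting the
  colours separately at each clique.
\<close>

section \<open>Graphs, cliques and completion of partial injections\<close>

lemma pair_graph_iff:
  "pair_graph G \<longleftrightarrow>
     finite (pverts G) \<and> parcs G \<subseteq> pverts G \<times> pverts G \<and> sym (parcs G) \<and> irrefl (parcs G)"
proof
  assume "pair_graph G"
  then interpret pair_graph G .
  show "finite (pverts G) \<and> parcs G \<subseteq> pverts G \<times> pverts G \<and> sym (parcs G) \<and> irrefl (parcs G)"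
    using pair_finite_verts in_arcsD1 in_arcsD2 pair_no_loops pair_sym_arcs
    by (fastforce simp: irrefl_def symmetric_def)
next
  assume *: "finite (pverts G) \<and> parcs G \<subseteq> pverts G \<times> pverts G \<and> sym (parcs G) \<and> irrefl (parcs G)"
  then have "finite (parcs G)"
    by (meson finite_SigmaI finite_subset)
  with * show "pair_graph G"
    by unfold_locales (auto simp: irrefl_def symmetric_def)
qed

lemma K_free_hom:
  assumes "K_free m G" "h ` pverts H \<subseteq> pverts G"
    and "\<And>x y. (x, y) \<in> parcs H \<Longrightarrow> (h x, h y) \<in> parcs G"
  shows "K_free m H"
  unfolding K_free_def
proof (rule notI, elim exE conjE)
  fix a :: "nat \<Rightarrow> 'b"
  assume "\<forall>i\<in>{1..m}. a i \<in> pverts H"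
    and "\<forall>i\<in>{1..m}. \<forall>j\<in>{1..m}. i < j \<longrightarrow> (a i, a j) \<in> parcs H"
  with assms(2,3) have "(\<forall>i\<in>{1..m}. (h \<circ> a) i \<in> pverts G) \<and>
      (\<forall>i\<in>{1..m}. \<forall>j\<in>{1..m}. i < j \<longrightarrow> ((h \<circ> a) i, (h \<circ> a) j) \<in> parcs G)"
    by auto
  with assms(1) show False
    unfolding K_free_def by blast
qed

text \<open>Cliques are taken as sets rather than as the sequences of \<open>K_free\<close>, so that
  they can index colours and be moved by automorphisms. The next lemmas translate between the two
  forms.\<close>

definition cliques :: "nat \<Rightarrow> 'a pair_pre_digraph \<Rightarrow> 'a set set" where
  "cliques m G = {I. I \<subseteq> pverts G \<and> card I = m \<and> pairwise (\<lambda>x y. (x, y) \<in> parcs G) I}"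

lemma clique_image:
  assumes "I \<in> cliques m G" "inj_on f I" "f ` I \<subseteq> pverts H"
    and "\<And>x y. x \<in> I \<Longrightarrow> y \<in> I \<Longrightarrow> (x, y) \<in> parcs G \<Longrightarrow> (f x, f y) \<in> parcs H"
  shows "f ` I \<in> cliques m H"
proof -
  have "pairwise (\<lambda>x y. (x, y) \<in> parcs H) (f ` I)"
    using assms(1,4) unfolding cliques_def pairwise_image by (auto simp: pairwise_def)
  then show ?thesis
    using assms(1-3) by (simp add: cliques_def card_image)
qed

lemma K_free_imp_no_cliques:
  assumes "K_free m G" "finite (pverts G)"
  shows "cliques m G = {}"
proof (rule ccontr)
  assume "cliques m G \<noteq> {}"
  then obtain I where I: "I \<subseteq> pverts G" "card I = m" "pairwise (\<lambda>x y. (x, y) \<in> parcs G) I"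
    unfolding cliques_def by blast
  have "finite I"
    using I(1) assms(2) finite_subset by blast
  then obtain a where a: "bij_betw a {1..m} I"
    using ex_bij_betw_nat_finite_1 I(2) by blast
  have "a i \<in> I" if "i \<in> {1..m}" for i
    using a that by (auto simp: bij_betw_def)
  moreover have "a i \<noteq> a j" if "i \<in> {1..m}" "j \<in> {1..m}" "i < j" for i j
    using a that by (metis bij_betw_def inj_onD nat_neq_iff)
  ultimately have "(\<forall>i\<in>{1..m}. a i \<in> pverts G) \<and>
      (\<forall>i\<in>{1..m}. \<forall>j\<in>{1..m}. i < j \<longrightarrow> (a i, a j) \<in> parcs G)"
    using I by (auto simp: pairwise_def)
  with assms(1) show False
    unfolding K_free_def by blast
qed

text \<open>Symmetry supplies the arcs with i > j, and irreflexivity then makes the sequence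
  injective, so its range has exactly m elements.\<close>

lemma clique_of_sequence:
  assumes "irrefl (parcs G)" "sym (parcs G)" "\<And>i. i \<in> {1..m} \<Longrightarrow> a i \<in> pverts G"
    and "\<And>i j. i \<in> {1..m} \<Longrightarrow> j \<in> {1..m} \<Longrightarrow> i < j \<Longrightarrow> (a i, a j) \<in> parcs G"
  shows "a ` {1..m} \<in> cliques m G"
proof -
  have arc: "(a i, a j) \<in> parcs G" if "i \<in> {1..m}" "j \<in> {1..m}" "i \<noteq> j" for i j
    using that assms(2,4) by (metis linorder_neqE_nat symD)
  then have "inj_on a {1..m}"
    using assms(1) by (metis inj_onI irrefl_def)
  then have "card (a ` {1..m}) = m"
    by (simp add: card_image)
  moreover have "pairwise (\<lambda>x y. (x, y) \<in> parcs G) (a ` {1..m})"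
    unfolding pairwise_image using arc by (auto simp: pairwise_def)
  ultimately show ?thesis
    using assms(3) unfolding cliques_def by blast
qed

text \<open>In a finite set the complements of \<open>D\<close> and of its image have the same size,
  so any bijection between them completes \<open>p\<close>. This is applied both to vertices and to
  colours.\<close>

lemma extend_to_permutation:
  assumes "finite V" "D \<subseteq> V" "inj_on p D" "p ` D \<subseteq> V"
  obtains \<pi> where "bij_betw \<pi> V V" "\<And>x. x \<in> D \<Longrightarrow> \<pi> x = p x"
proof -
  have "finite D"
    using assms(1,2) finite_subset by blast
  then have "card (V - D) = card (V - p ` D)"
    using assms by (simp add: card_Diff_subset card_image)
  then obtain q where q: "bij_betw q (V - D) (V - p ` D)"
    using finite_same_card_bij assms(1) by blast
  have "bij_betw (\<lambda>x. if x \<in> D then p x else q x) (D \<union> (V - D)) (p ` D \<union> (V - p ` D))"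
    by (rule bij_betw_disjoint_Un[OF inj_on_imp_bij_betw[OF assms(3)] q]) auto
  moreover have "D \<union> (V - D) = V" "p ` D \<union> (V - p ` D) = V"
    using assms by auto
  ultimately show ?thesis
    by (intro that[of "\<lambda>x. if x \<in> D then p x else q x"]) auto
qed

lemma graph_automorphismI:
  assumes "finite (pverts G)" "inj_on f (pverts G)" "f ` pverts G \<subseteq> pverts G"
    and "\<And>a b. a \<in> pverts G \<Longrightarrow> b \<in> pverts G \<Longrightarrow> (a, b) \<in> parcs G \<longleftrightarrow> (f a, f b) \<in> parcs G"
  shows "graph_automorphism G f"
  unfolding graph_automorphism_def bij_betw_def
  using endo_inj_surj[OF assms(1,3,2)] assms(2,4) by auto

section \<open>Extension of partial isomorphisms, ignoring cliques\<close>

definition graph_embedding ::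
  "'a pair_pre_digraph \<Rightarrow> ('a \<Rightarrow> 'b) \<Rightarrow> 'b pair_pre_digraph \<Rightarrow> bool" where
  "graph_embedding A e B \<longleftrightarrow>
     inj_on e (pverts A) \<and> e ` pverts A \<subseteq> pverts B \<and>
     (\<forall>a\<in>pverts A. \<forall>b\<in>pverts A. (a, b) \<in> parcs A \<longleftrightarrow> (e a, e b) \<in> parcs B)"

text \<open>One graph \<open>B\<close> serves all partial isomorphisms of \<open>A\<close> at once;
  the given finite family is picked out only at the end. The embedding \<open>e\<close> is a
  parameter because each construction changes the vertex type.\<close>

definition extension_witness ::
  "'a pair_pre_digraph \<Rightarrow> ('a \<Rightarrow> 'b) \<Rightarrow> 'b pair_pre_digraph \<Rightarrow> bool" where
  "extension_witness A e B \<longleftrightarrow>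
     pair_graph B \<and> graph_embedding A e B \<and>
     (\<forall>p. partial_isomorphism A p \<longrightarrow>
        (\<exists>f. graph_automorphism B f \<and> (\<forall>a b. p a = Some b \<longrightarrow> f (e a) = e b)))"

lemma ex_extension_witness:
  fixes A :: "'a pair_pre_digraph"
  assumes "pair_graph A"
  shows "\<exists>(B :: ('a \<times> 'a set) pair_pre_digraph) e. extension_witness A e B"
proof -
  define V where "V = pverts A"
  define E where "E x y \<longleftrightarrow> (x, y) \<in> parcs A" for x y
  have finV: "finite V" and E_V: "\<And>x y. E x y \<Longrightarrow> x \<in> V \<and> y \<in> V"
    and E_sym: "\<And>x y. E x y \<longleftrightarrow> E y x" and E_irrefl: "\<And>x. \<not> E x x"
    using assms unfolding pair_graph_iff V_def E_def by (auto simp: irrefl_def dest: symD)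
  \<comment> \<open>\<open>g\<close> only serves to order the vertices. \<open>S x\<close> then
    records each edge at its \<open>g\<close>-larger end alone, so exactly one of the two
    memberships holds for an edge and neither for a non-edge, which is what \<open>adj\<close>
    tests.\<close>
  obtain g :: "'a \<Rightarrow> nat" where g: "inj_on g V"
    using finite_imp_inj_to_nat_seg[OF finV] by blast
  define S where "S x = {y. E x y \<and> g y < g x}" for x
  have S_V: "S x \<subseteq> V" for x
    using E_V by (auto simp: S_def)
  have E_iff: "E x y \<longleftrightarrow> (y \<in> S x) \<noteq> (x \<in> S y)" for x y
  proof -
    have "g x < g y \<or> g y < g x" if "E x y"
      using E_V[OF that] E_irrefl[of x] that inj_onD[OF g, of x y] by (metis nat_neq_iff)
    then show ?thesis
      unfolding S_def mem_Collect_eq using E_sym[of x y] by linarith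
  qed
  define adj :: "'a \<times> 'a set \<Rightarrow> 'a \<times> 'a set \<Rightarrow> bool" where
    "adj u v \<longleftrightarrow> fst u \<noteq> fst v \<and> (fst v \<in> snd u) \<noteq> (fst u \<in> snd v)" for u v
  define W where "W = V \<times> Pow V"
  define B where "B = \<lparr>pverts = W, parcs = {(u, v). u \<in> W \<and> v \<in> W \<and> adj u v}\<rparr>"
  define e where "e x = (x, S x)" for x
  have "finite W"
    using finV by (simp add: W_def)
  then have "pair_graph B"
    unfolding pair_graph_iff by (auto simp: B_def sym_def irrefl_def adj_def)
  moreover have "graph_embedding A e B"
    unfolding graph_embedding_def
  proof (intro conjI ballI)
    show "inj_on e (pverts A)"
      by (auto simp: inj_on_def e_def)
    show "e ` pverts A \<subseteq> pverts B"
      using S_V by (auto simp: e_def B_def W_def V_def)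
    show "(a, b) \<in> parcs A \<longleftrightarrow> (e a, e b) \<in> parcs B" if "a \<in> pverts A" "b \<in> pverts A" for a b
      using that S_V E_iff[of a b] E_irrefl[of a]
      by (auto simp: e_def B_def W_def V_def E_def adj_def)
  qed
  moreover have "\<exists>f. graph_automorphism B f \<and> (\<forall>a b. p a = Some b \<longrightarrow> f (e a) = e b)"
    if p: "partial_isomorphism A p" for p
  proof -
    define D where "D = dom p"
    have D: "D \<subseteq> V" and inj: "inj_on (the \<circ> p) D" and ran: "(the \<circ> p) ` D \<subseteq> V"
      using p by (auto simp: partial_isomorphism_def D_def V_def inj_on_def dom_def ran_def)
    obtain \<pi> where \<pi>: "bij_betw \<pi> V V" and \<pi>_p: "\<And>x. x \<in> D \<Longrightarrow> \<pi> x = the (p x)"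
      using extend_to_permutation[OF finV D inj ran] by auto
    have E_\<pi>: "E (\<pi> x) (\<pi> y) \<longleftrightarrow> E x y" if "x \<in> D" "y \<in> D" for x y
      using p that \<pi>_p by (auto simp: partial_isomorphism_def D_def E_def)
    have \<pi>_V: "\<pi> x \<in> V" if "x \<in> V" for x
      using \<pi> that by (auto simp: bij_betw_def)
    have \<pi>_eq: "\<pi> x = \<pi> y \<longleftrightarrow> x = y" if "x \<in> V" "y \<in> V" for x y
      using \<pi> that by (auto simp: bij_betw_def inj_on_def)
    define d where "d x y \<longleftrightarrow> (y \<in> S x) \<noteq> (\<pi> y \<in> S (\<pi> x))" for x y
    text \<open>Membership is flipped at the pairs in \<open>F\<close>: by symmetry the flips cancel in \<open>adj\<close>, and for
      \<open>x \<in> D\<close> they carry \<open>S x\<close> to \<open>S (\<pi> x)\<close>.\<close>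
    define F where "F x y \<longleftrightarrow> (if x \<in> D then d x y else y \<in> D \<and> d y x)" for x y
    \<comment> \<open>The definition of \<open>F\<close> settles all cases except x and y both in
      \<open>D\<close>. There \<open>d x y\<close> and \<open>d y x\<close> agree because \<pi>
      preserves \<open>E\<close> on \<open>D\<close>, and by \<open>E_iff\<close> the two
      memberships for a pair have a parity determined by \<open>E\<close>.\<close>
    have F_sym: "F x y \<longleftrightarrow> F y x" for x y
      using E_\<pi>[of x y] E_iff[of x y] E_iff[of "\<pi> x" "\<pi> y"] by (auto simp: F_def d_def)
    define f where "f u = (\<pi> (fst u), \<pi> ` {y \<in> V. (y \<in> snd u) \<noteq> F (fst u) y})" for u
    have mem_f: "\<pi> y \<in> snd (f u) \<longleftrightarrow> (y \<in> snd u) \<noteq> F (fst u) y" if "y \<in> V" for y u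
      using that \<pi>_eq by (auto simp: f_def)
    have f_W: "f u \<in> W" if "u \<in> W" for u
      using that \<pi>_V by (auto simp: f_def W_def)
    have f_inj: "inj_on f W"
    proof (rule inj_onI)
      fix u v assume uv: "u \<in> W" "v \<in> W" "f u = f v"
      then have fst: "fst u = fst v"
        using \<pi>_eq by (auto simp: f_def W_def)
      have "y \<in> snd u \<longleftrightarrow> y \<in> snd v" if "y \<in> V" for y
        using mem_f[OF that, of u] mem_f[OF that, of v] uv(3) fst by auto
      then have "snd u = snd v"
        using uv(1,2) by (auto simp: W_def)
      with fst show "u = v"
        by (simp add: prod_eq_iff)
    qed
    have "adj (f u) (f v) \<longleftrightarrow> adj u v" if "u \<in> W" "v \<in> W" for u v
    proof -
      have V: "fst u \<in> V" "fst v \<in> V"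
        using that by (auto simp: W_def)
      have "fst (f u) = \<pi> (fst u)" "fst (f v) = \<pi> (fst v)"
        by (simp_all add: f_def)
      then show ?thesis
        unfolding adj_def using mem_f V \<pi>_eq F_sym[of "fst u" "fst v"] by auto
    qed
    then have "graph_automorphism B f"
      using \<open>finite W\<close> f_inj f_W by (intro graph_automorphismI) (auto simp: B_def)
    moreover have "f (e a) = e b" if ab: "p a = Some b" for a b
    proof -
      have a: "a \<in> D" "\<pi> a = b"
        using ab \<pi>_p[of a] by (auto simp: D_def)
      have "{y \<in> V. (y \<in> S a) \<noteq> F a y} = {y \<in> V. \<pi> y \<in> S b}"
        using a by (auto simp: F_def d_def)
      moreover have "S b \<subseteq> \<pi> ` V"
        using S_V[of b] bij_betw_imp_surj_on[OF \<pi>] by simp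
      then have "\<pi> ` {y \<in> V. \<pi> y \<in> S b} = S b"
        by auto
      ultimately show ?thesis
        using a by (simp add: f_def e_def)
    qed
    ultimately show ?thesis by blast
  qed
  ultimately show ?thesis
    unfolding extension_witness_def by blast
qed

section \<open>Removal of m-cliques by colourings\<close>

lemma K_free_extension_witness:
  fixes A :: "'a pair_pre_digraph" and B :: "'b pair_pre_digraph"
  assumes "m \<ge> 1" "pair_graph A" "K_free m A" "extension_witness A e B"
  shows "\<exists>(C :: ('b \<times> ('b set \<Rightarrow> nat)) pair_pre_digraph) e'.
    extension_witness A e' C \<and> K_free m C"
proof -
  define V where "V = pverts A"
  have finV: "finite V" and finB: "finite (pverts B)" and B: "pair_graph B"
    and parcs_B: "sym (parcs B)" "irrefl (parcs B)"
    using assms by (auto simp: pair_graph_iff extension_witness_def V_def)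
  have e_inj: "inj_on e V" and e_B: "e ` V \<subseteq> pverts B"
    and e_arcs: "\<And>a b. a \<in> V \<Longrightarrow> b \<in> V \<Longrightarrow> (a, b) \<in> parcs A \<longleftrightarrow> (e a, e b) \<in> parcs B"
    using assms(4) by (auto simp: extension_witness_def graph_embedding_def V_def)
  have fin_cliques: "finite (cliques m B)"
    by (rule finite_subset[of _ "Pow (pverts B)"]) (use finB in \<open>auto simp: cliques_def\<close>)
  define U where "U x = {I \<in> cliques m B. x \<in> I}" for x
  \<comment> \<open>\<open>\<rightarrow>\<^sub>E\<close> fixes the value off \<open>U x\<close>, so
    \<open>W\<close> is finite and a valuation is determined by its colours on \<open>U x\<close>.
    For m = 1 there are no colours and every vertex of \<open>B\<close> is itself a 1-clique, so
    \<open>W\<close> is empty, in accordance with \<open>A\<close> being empty.\<close>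
  define W where "W = (SIGMA x : pverts B. U x \<rightarrow>\<^sub>E {..<m-1})"
  have W_iff: "u \<in> W \<longleftrightarrow> fst u \<in> pverts B \<and> snd u \<in> U (fst u) \<rightarrow>\<^sub>E {..<m-1}" for u
    by (cases u) (simp add: W_def)
  define adj :: "'b \<times> ('b set \<Rightarrow> nat) \<Rightarrow> 'b \<times> ('b set \<Rightarrow> nat) \<Rightarrow> bool" where
    "adj u v \<longleftrightarrow> (fst u, fst v) \<in> parcs B \<and>
       (\<forall>I \<in> U (fst u) \<inter> U (fst v). snd u I \<noteq> snd v I)" for u v
  define C where "C = \<lparr>pverts = W, parcs = {(u, v). u \<in> W \<and> v \<in> W \<and> adj u v}\<rparr>"
  have "finite W"
    unfolding W_def using finB fin_cliques by (intro finite_SigmaI finite_PiE) (auto simp: U_def)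
  then have "pair_graph C"
    using parcs_B unfolding pair_graph_iff
    by (auto simp: C_def adj_def sym_def irrefl_def dest: not_sym)
  have "K_free m C"
    unfolding K_free_def
  proof (rule notI, elim exE conjE)
    fix a :: "nat \<Rightarrow> 'b \<times> ('b set \<Rightarrow> nat)"
    assume a_C: "\<forall>i\<in>{1..m}. a i \<in> pverts C"
      and arcs: "\<forall>i\<in>{1..m}. \<forall>j\<in>{1..m}. i < j \<longrightarrow> (a i, a j) \<in> parcs C"
    \<comment> \<open>\<open>fst\<close> preserves adjacency, so the supposed clique of
      \<open>C\<close> projects to an m-clique \<open>I\<close> of \<open>B\<close>. Each of its
      vertices has a colour at \<open>I\<close>, and adjacency in \<open>C\<close> makes these
      colours pairwise distinct.\<close>
    define I where "I = (fst \<circ> a) ` {1..m}"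
    have a_W: "fst (a i) \<in> pverts B" "snd (a i) \<in> U (fst (a i)) \<rightarrow>\<^sub>E {..<m-1}"
      if "i \<in> {1..m}" for i
      using bspec[OF a_C that] by (simp_all add: C_def W_iff)
    have a_adj: "adj (a i) (a j)" if "i \<in> {1..m}" "j \<in> {1..m}" "i < j" for i j
      using arcs that by (simp add: C_def)
    have I: "I \<in> cliques m B"
      unfolding I_def
      by (rule clique_of_sequence[OF parcs_B(2,1)])
        (use a_W(1) a_adj in \<open>simp_all add: adj_def\<close>)
    then have I_U: "I \<in> U (fst (a i))" if "i \<in> {1..m}" for i
      using that by (auto simp: U_def I_def)
    have "(\<lambda>i. snd (a i) I) ` {1..m} \<subseteq> {..<m-1}"
    proof (rule image_subsetI)
      fix i assume i: "i \<in> {1..m}"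
      show "snd (a i) I \<in> {..<m-1}"
        using PiE_mem[OF a_W(2)[OF i] I_U[OF i]] .
    qed
    moreover have "inj_on (\<lambda>i. snd (a i) I) {1..m}"
    proof (rule linorder_inj_onI')
      fix i j assume ij: "i \<in> {1..m}" "j \<in> {1..m}" "i < j"
      then show "snd (a i) I \<noteq> snd (a j) I"
        using I_U a_adj[OF ij] by (simp add: adj_def)
    qed
    \<comment> \<open>This contradicts m - 1 < m, which needs m >= 1 since subtraction is
      truncated.\<close>
    ultimately have "card {1..m} \<le> card {..<m-1}"
      using card_inj_on_le by blast
    then show False
      using assms(1) by simp
  qed
  \<comment> \<open>At most m vertices of \<open>A\<close> lie over \<open>I\<close>, since
    \<open>e\<close> is injective. Exactly m is impossible: arcs are reflected by \<open>e\<close>,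
    so these vertices would form an m-clique of \<open>A\<close>. Hence m - 1 colours
    suffice.\<close>
  have "\<exists>c. inj_on c {a \<in> V. e a \<in> I} \<and> c ` {a \<in> V. e a \<in> I} \<subseteq> {..<m-1}"
    if I: "I \<in> cliques m B" for I
  proof -
    define X where "X = {a \<in> V. e a \<in> I}"
    have X: "finite X" "inj_on e X" "e ` X \<subseteq> I" "X \<subseteq> V"
      using finV e_inj by (auto simp: X_def inj_on_def)
    have I': "finite I" "card I = m"
      using I finB finite_subset by (auto simp: cliques_def)
    have "card X \<noteq> m"
    proof
      assume "card X = m"
      moreover have "pairwise (\<lambda>a b. (a, b) \<in> parcs A) X"
        unfolding pairwise_def
      proof (intro ballI impI)
        fix a b assume ab: "a \<in> X" "b \<in> X" "a \<noteq> b"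
        then have "e a \<noteq> e b" "e a \<in> I" "e b \<in> I"
          using X by (auto simp: inj_on_def)
        then have "(e a, e b) \<in> parcs B"
          using I by (auto simp: cliques_def pairwise_def)
        then show "(a, b) \<in> parcs A"
          using e_arcs ab X(4) by blast
      qed
      ultimately have "X \<in> cliques m A"
        using X by (auto simp: cliques_def V_def)
      then show False
        using K_free_imp_no_cliques[OF assms(3)] finV by (auto simp: V_def)
    qed
    moreover have "card X \<le> m"
      using card_inj_on_le[OF X(2,3) I'(1)] I'(2) by simp
    ultimately have "card X \<le> card {..<m-1}"
      by simp
    then show ?thesis
      using card_le_inj[OF X(1), of "{..<m-1}"] unfolding X_def by blast
  qed
  then have "\<exists>c. \<forall>I\<in>cliques m B. inj_on (c I) {a \<in> V. e a \<in> I} \<and>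
      c I ` {a \<in> V. e a \<in> I} \<subseteq> {..<m-1}"
    by (intro bchoice ballI)
  then obtain c where c_inj: "\<And>I. I \<in> cliques m B \<Longrightarrow> inj_on (c I) {a \<in> V. e a \<in> I}"
    and c_less: "\<And>I. I \<in> cliques m B \<Longrightarrow> c I ` {a \<in> V. e a \<in> I} \<subseteq> {..<m-1}"
    by auto
  define e' where "e' a = (e a, \<lambda>I\<in>U (e a). c I a)" for a
  have e'_W: "e' a \<in> W" if "a \<in> V" for a
  proof -
    have "c I a \<in> {..<m-1}" if "I \<in> U (e a)" for I
      using that \<open>a \<in> V\<close> c_less[of I] unfolding U_def by blast
    then show ?thesis
      using that e_B unfolding W_iff e'_def by auto
  qed
  have "graph_embedding A e' C"
    unfolding graph_embedding_def V_def[symmetric]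
  proof (intro conjI ballI)
    show "inj_on e' V"
      using e_inj by (auto simp: inj_on_def e'_def)
    show "e' ` V \<subseteq> pverts C"
      using e'_W by (auto simp: C_def)
    fix a b assume ab: "a \<in> V" "b \<in> V"
    \<comment> \<open>This is why the lift keeps every edge of \<open>A\<close>: its ends are
      distinct vertices over any common clique, where \<open>c I\<close> is injective.\<close>
    have "c I a \<noteq> c I b" if "I \<in> U (e a) \<inter> U (e b)" "(e a, e b) \<in> parcs B" for I
    proof -
      have "a \<noteq> b"
        using that(2) parcs_B(2) by (auto simp: irrefl_def)
      then show ?thesis
        using that(1) c_inj[of I] ab by (auto simp: U_def inj_on_def)
    qed
    then show "(a, b) \<in> parcs A \<longleftrightarrow> (e' a, e' b) \<in> parcs C"
      using ab e'_W e_arcs by (auto simp: C_def adj_def e'_def)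
  qed
  moreover have "\<exists>F. graph_automorphism C F \<and> (\<forall>a b. p a = Some b \<longrightarrow> F (e' a) = e' b)"
    if p: "partial_isomorphism A p" for p
  proof -
    obtain f where f: "graph_automorphism B f" and f_e: "\<And>a b. p a = Some b \<Longrightarrow> f (e a) = e b"
      using assms(4) p unfolding extension_witness_def by blast
    have f_bij: "bij_betw f (pverts B) (pverts B)"
      and f_arcs: "\<And>x y. x \<in> pverts B \<Longrightarrow> y \<in> pverts B \<Longrightarrow>
        (f x, f y) \<in> parcs B \<longleftrightarrow> (x, y) \<in> parcs B"
      using f by (auto simp: graph_automorphism_def)
    have f_B: "f x \<in> pverts B" if "x \<in> pverts B" for x
      using f_bij that by (auto simp: bij_betw_def)
    have f_inj: "inj_on f (pverts B)"
      using f_bij by (auto simp: bij_betw_def)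
    have p_V: "a \<in> V \<and> b \<in> V" if "p a = Some b" for a b
      using p that by (auto simp: partial_isomorphism_def V_def dom_def ran_def)
    have p_inj: "a = a'" if "p a = Some b" "p a' = Some b" for a a' b
      using p that by (auto simp: partial_isomorphism_def inj_on_def dom_def)
    have img: "f ` I \<in> cliques m B" if "I \<in> cliques m B" for I
    proof (rule clique_image[OF that])
      show "inj_on f I"
        using that f_inj by (auto simp: cliques_def intro: inj_on_subset)
    qed (use that f_B f_arcs in \<open>auto simp: cliques_def\<close>)
    \<comment> \<open>\<open>g\<close> inverts the action of \<open>f\<close> on cliques. The
      preimage is cut down to \<open>pverts B\<close> because nothing is known about
      \<open>f\<close> elsewhere.\<close>
    define g where "g J = {x \<in> pverts B. f x \<in> J}" for J
    have g_img: "g (f ` I) = I" if "I \<in> cliques m B" for I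
      using that f_inj by (auto simp: g_def cliques_def dest: inj_onD)
    have img_g: "f ` g J = J" if "J \<in> cliques m B" for J
      using that f_bij by (force simp: g_def cliques_def bij_betw_def)
    have g_cliques: "g J \<in> cliques m B" if J: "J \<in> cliques m B" for J
    proof -
      have "bij_betw f (g J) J"
        using img_g[OF J] f_inj unfolding bij_betw_def by (auto simp: g_def inj_on_def)
      then have "card (g J) = m"
        using J bij_betw_same_card by (auto simp: cliques_def)
      moreover have "pairwise (\<lambda>x y. (x, y) \<in> parcs B) (g J)"
        unfolding pairwise_def
      proof (intro ballI impI)
        fix x y assume xy: "x \<in> g J" "y \<in> g J" "x \<noteq> y"
        then have "f x \<noteq> f y"
          using f_inj by (auto simp: g_def inj_on_def)
        then have "(f x, f y) \<in> parcs B"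
          using J xy by (auto simp: g_def cliques_def pairwise_def)
        then show "(x, y) \<in> parcs B"
          using xy f_arcs by (simp add: g_def)
      qed
      ultimately show ?thesis
        by (auto simp: cliques_def g_def)
    qed
    have g_U: "g J \<in> U x" if "x \<in> pverts B" "J \<in> U (f x)" for x J
      using that g_cliques by (auto simp: U_def g_def)
    have img_U: "f ` I \<in> U (f x)" if "I \<in> U x" for I x
      using that img by (auto simp: U_def)
    \<comment> \<open>To carry the lift of a to the lift of \<open>p a\<close>, the colour of a at
      \<open>I\<close> must become the colour of \<open>p a\<close> at the image of
      \<open>I\<close>. The map \<open>q\<close> does this by decoding a colour to its vertex: it is
      well defined since \<open>c I\<close> is injective, and injective since \<open>p\<close> and
      the colouring of the image clique are. It therefore extends to a permutation of the
      colours.\<close>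
    have "\<exists>\<tau>. bij_betw \<tau> {..<m-1} {..<m-1} \<and>
        (\<forall>a b. p a = Some b \<longrightarrow> e a \<in> I \<longrightarrow> \<tau> (c I a) = c (f ` I) b)"
      if I: "I \<in> cliques m B" for I
    proof -
      define X where "X = {a \<in> dom p. e a \<in> I}"
      define q where "q v = c (f ` I) (the (p (inv_into X (c I) v)))" for v
      have X_V: "X \<subseteq> {a \<in> V. e a \<in> I}"
        using p_V by (auto simp: X_def)
      then have cX: "inj_on (c I) X"
        using c_inj[OF I] inj_on_subset by blast
      have q: "q (c I a) = c (f ` I) (the (p a))" if "a \<in> X" for a
        using that cX by (simp add: q_def)
      have p_mem: "the (p a) \<in> {b \<in> V. e b \<in> f ` I}" if "a \<in> X" for a
        using that p_V f_e by (force simp: X_def)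
      have "inj_on q (c I ` X)"
      proof (rule inj_onI, elim imageE, simp)
        fix a a' assume a: "a \<in> X" "a' \<in> X" "q (c I a) = q (c I a')"
        then have "the (p a) = the (p a')"
          using q p_mem c_inj[OF img[OF I]] by (metis (no_types, lifting) inj_onD)
        then have "a = a'"
          using a p_inj by (auto simp: X_def)
        then show "c I a = c I a'"
          by simp
      qed
      moreover have "q ` c I ` X \<subseteq> {..<m-1}"
        using q p_mem c_less[OF img[OF I]] by force
      moreover have "c I ` X \<subseteq> {..<m-1}"
        using c_less[OF I] X_V by blast
      ultimately obtain \<tau> where \<tau>: "bij_betw \<tau> {..<m-1} {..<m-1}"
        "\<And>v. v \<in> c I ` X \<Longrightarrow> \<tau> v = q v"
        using extend_to_permutation[of "{..<m-1}" "c I ` X" q] by auto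
      have "\<tau> (c I a) = c (f ` I) b" if "p a = Some b" "e a \<in> I" for a b
      proof -
        have "a \<in> X"
          using that by (auto simp: X_def)
        then show ?thesis
          using that(1) \<tau>(2) q by simp
      qed
      with \<tau>(1) show ?thesis by blast
    qed
    then have "\<exists>\<tau>. \<forall>I\<in>cliques m B. bij_betw (\<tau> I) {..<m-1} {..<m-1} \<and>
        (\<forall>a b. p a = Some b \<longrightarrow> e a \<in> I \<longrightarrow> \<tau> I (c I a) = c (f ` I) b)"
      by (intro bchoice ballI)
    then obtain \<tau> where \<tau>: "\<And>I. I \<in> cliques m B \<Longrightarrow> bij_betw (\<tau> I) {..<m-1} {..<m-1}"
      and \<tau>_c: "\<And>I a b. I \<in> cliques m B \<Longrightarrow> p a = Some b \<Longrightarrow> e a \<in> I \<Longrightarrow>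
        \<tau> I (c I a) = c (f ` I) b"
      by blast
    \<comment> \<open>The new colour at \<open>J\<close> is the old colour at the preimage clique
      \<open>g J\<close>, permuted by the \<tau> chosen for that source clique.\<close>
    define F where "F u = (f (fst u), \<lambda>J\<in>U (f (fst u)). \<tau> (g J) (snd u (g J)))" for u
    have snd_W: "snd u I < m - 1" if "u \<in> W" "I \<in> U (fst u)" for u I
      using that by (auto simp: W_iff PiE_iff)
    have \<tau>_eq: "\<tau> I i = \<tau> I j \<longleftrightarrow> i = j" if "I \<in> cliques m B" "i < m - 1" "j < m - 1" for I i j
      using \<tau>[OF that(1)] that(2,3) by (auto simp: bij_betw_def inj_on_def)
    have F_img: "snd (F u) (f ` I) = \<tau> I (snd u I)" if "I \<in> U (fst u)" for u I
      using that img_U[OF that] g_img by (auto simp: F_def U_def)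
    have F_W: "F u \<in> W" if u: "u \<in> W" for u
    proof -
      have x: "fst u \<in> pverts B"
        using u by (simp add: W_iff)
      have "\<tau> (g J) (snd u (g J)) \<in> {..<m-1}" if "J \<in> U (f (fst u))" for J
      proof -
        have "g J \<in> U (fst u)"
          using g_U[OF x that] .
        then show ?thesis
          using \<tau>[of "g J"] snd_W[OF u] by (auto simp: U_def bij_betw_def)
      qed
      then show ?thesis
        using f_B[OF x] unfolding F_def W_iff by auto
    qed
    have F_inj: "inj_on F W"
    proof (rule inj_onI)
      fix u v assume uv: "u \<in> W" "v \<in> W" "F u = F v"
      then have fst: "fst u = fst v"
        using f_inj by (auto simp: F_def W_iff inj_on_def)
      have "snd u I = snd v I" if I: "I \<in> U (fst u)" for I
      proof -
        have "\<tau> I (snd u I) = \<tau> I (snd v I)"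
          using F_img[of I u] F_img[of I v] I fst uv(3) by simp
        then show ?thesis
          using \<tau>_eq snd_W uv(1,2) I fst by (auto simp: U_def)
      qed
      then have "snd u = snd v"
        using uv(1,2) fst by (intro PiE_ext[of _ "U (fst u)" "\<lambda>_. {..<m-1}"]) (auto simp: W_iff)
      with fst show "u = v"
        by (simp add: prod_eq_iff)
    qed
    have "adj (F u) (F v) \<longleftrightarrow> adj u v" if uv: "u \<in> W" "v \<in> W" for u v
    proof -
      have x: "fst u \<in> pverts B" "fst v \<in> pverts B"
        using uv by (auto simp: W_iff)
      have F_fst: "fst (F u) = f (fst u)" "fst (F v) = f (fst v)"
        by (simp_all add: F_def)
      \<comment> \<open>The cliques to be compared after applying \<open>F\<close> are exactly the
        images of those compared before. At each of them both colours pass through the same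
        injective \<open>\<tau> I\<close>, so they differ after \<open>F\<close> iff they differed
        before.\<close>
      have U_img: "U (f (fst u)) \<inter> U (f (fst v)) = image f ` (U (fst u) \<inter> U (fst v))"
      proof (intro equalityI subsetI)
        fix J assume J: "J \<in> U (f (fst u)) \<inter> U (f (fst v))"
        then have "J = f ` g J"
          using img_g by (auto simp: U_def)
        then show "J \<in> image f ` (U (fst u) \<inter> U (fst v))"
          using J g_U x by blast
      qed (use img_U in blast)
      have "snd (F u) (f ` I) \<noteq> snd (F v) (f ` I) \<longleftrightarrow> snd u I \<noteq> snd v I"
        if "I \<in> U (fst u) \<inter> U (fst v)" for I
        using that F_img \<tau>_eq snd_W uv by (auto simp: U_def)
      then show ?thesis
        unfolding adj_def F_fst U_img using f_arcs[OF x] by auto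
    qed
    then have "graph_automorphism C F"
      using \<open>finite W\<close> F_inj F_W by (intro graph_automorphismI) (auto simp: C_def)
    moreover have "F (e' a) = e' b" if ab: "p a = Some b" for a b
    proof -
      have a: "e a \<in> pverts B" "f (e a) = e b"
        using ab p_V e_B f_e by auto
      \<comment> \<open>This is the defining property \<open>\<tau>_c\<close> at the clique
        \<open>g J\<close>, whose image under \<open>f\<close> is \<open>J\<close>.\<close>
      have "\<tau> (g J) ((\<lambda>I\<in>U (e a). c I a) (g J)) = c J b" if J: "J \<in> U (e b)" for J
      proof -
        have gJ: "g J \<in> U (e a)" "J \<in> cliques m B"
          using g_U[OF a(1)] J a(2) by (auto simp: U_def)
        then have "\<tau> (g J) (c (g J) a) = c (f ` g J) b"
          using \<tau>_c ab by (auto simp: U_def)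
        then show ?thesis
          using gJ img_g by simp
      qed
      then show ?thesis
        using a(2) by (auto simp: F_def e'_def)
    qed
    ultimately show ?thesis by blast
  qed
  ultimately show ?thesis
    using \<open>pair_graph C\<close> \<open>K_free m C\<close> unfolding extension_witness_def by blast
qed

section \<open>Transport to the vertex type \<open>'a + nat\<close>\<close>

lemma extension_witness_relocate:
  assumes "extension_witness A e B" "inj_on h (pverts B)"
  shows "extension_witness A (h \<circ> e) (graph_image h B)"
proof -
  have B: "finite (pverts B)" "parcs B \<subseteq> pverts B \<times> pverts B" "sym (parcs B)" "irrefl (parcs B)"
    and e: "inj_on e (pverts A)" "e ` pverts A \<subseteq> pverts B"
      "\<And>a b. a \<in> pverts A \<Longrightarrow> b \<in> pverts A \<Longrightarrow> (a, b) \<in> parcs A \<longleftrightarrow> (e a, e b) \<in> parcs B"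
    using assms(1) by (auto simp: extension_witness_def graph_embedding_def pair_graph_iff)
  have arcs: "(h x, h y) \<in> parcs (graph_image h B) \<longleftrightarrow> (x, y) \<in> parcs B"
    if "x \<in> pverts B" "y \<in> pverts B" for x y
    using that B(2) by (auto simp: graph_image_def dest: inj_onD[OF assms(2)])
  have "pair_graph (graph_image h B)"
    unfolding pair_graph_iff
  proof (intro conjI)
    show "irrefl (parcs (graph_image h B))"
      using B(2,4) inj_onD[OF assms(2)] by (fastforce simp: graph_image_def irrefl_def)
  qed (use B in \<open>auto simp: graph_image_def sym_def\<close>)
  moreover have "graph_embedding A (h \<circ> e) (graph_image h B)"
    unfolding graph_embedding_def
  proof (intro conjI ballI)
    show "inj_on (h \<circ> e) (pverts A)"
      using comp_inj_on[OF e(1)] inj_on_subset[OF assms(2) e(2)] by blast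
    show "(h \<circ> e) ` pverts A \<subseteq> pverts (graph_image h B)"
      using e(2) by (auto simp: graph_image_def)
    show "(a, b) \<in> parcs A \<longleftrightarrow> ((h \<circ> e) a, (h \<circ> e) b) \<in> parcs (graph_image h B)"
      if "a \<in> pverts A" "b \<in> pverts A" for a b
      using that e(2,3) arcs by (auto simp: image_subset_iff)
  qed
  moreover have "\<exists>f. graph_automorphism (graph_image h B) f \<and>
      (\<forall>a b. p a = Some b \<longrightarrow> f ((h \<circ> e) a) = (h \<circ> e) b)"
    if p: "partial_isomorphism A p" for p
  proof -
    obtain f where f: "graph_automorphism B f" and f_e: "\<And>a b. p a = Some b \<Longrightarrow> f (e a) = e b"
      using assms(1) p unfolding extension_witness_def by blast
    \<comment> \<open>Automorphisms are transported by conjugation: \<open>k\<close> decodes a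
      vertex of the copy, \<open>f\<close> acts, and \<open>h\<close> encodes the result.\<close>
    define k where "k = inv_into (pverts B) h"
    have k: "k (h x) = x" if "x \<in> pverts B" for x
      using that assms(2) by (simp add: k_def)
    have f_bij: "inj_on f (pverts B)" "\<And>x. x \<in> pverts B \<Longrightarrow> f x \<in> pverts B"
      using f by (auto simp: graph_automorphism_def bij_betw_def)
    have "graph_automorphism (graph_image h B) (h \<circ> f \<circ> k)"
    proof (rule graph_automorphismI)
      show "inj_on (h \<circ> f \<circ> k) (pverts (graph_image h B))"
        by (rule inj_onI)
          (auto simp: graph_image_def k f_bij(2) inj_on_eq_iff[OF assms(2)] inj_on_eq_iff[OF f_bij(1)])
      show "(a, b) \<in> parcs (graph_image h B) \<longleftrightarrow>
          ((h \<circ> f \<circ> k) a, (h \<circ> f \<circ> k) b) \<in> parcs (graph_image h B)"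
        if ab: "a \<in> pverts (graph_image h B)" "b \<in> pverts (graph_image h B)" for a b
      proof -
        obtain x y where xy: "x \<in> pverts B" "a = h x" "y \<in> pverts B" "b = h y"
          using ab by (auto simp: graph_image_def)
        then have "(x, y) \<in> parcs B \<longleftrightarrow> (f x, f y) \<in> parcs B"
          using f unfolding graph_automorphism_def by blast
        then show ?thesis
          using xy by (simp add: arcs f_bij(2) k)
      qed
    qed (use B(1) k f_bij in \<open>auto simp: graph_image_def\<close>)
    moreover have "(h \<circ> f \<circ> k) ((h \<circ> e) a) = (h \<circ> e) b" if ab: "p a = Some b" for a b
    proof -
      have "a \<in> pverts A"
        using p ab by (auto simp: partial_isomorphism_def)
      then show ?thesis
        using e(2) k f_e[OF ab] by (auto simp: image_subset_iff)
    qed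
    ultimately show ?thesis by blast
  qed
  ultimately show ?thesis
    unfolding extension_witness_def by blast
qed

text \<open>Decoding by the inverse of \<open>h\<close> is a homomorphism from the copy back to
  \<open>G\<close>.\<close>

lemma K_free_graph_image:
  assumes "K_free m G" "inj_on h (pverts G)" "parcs G \<subseteq> pverts G \<times> pverts G"
  shows "K_free m (graph_image h G)"
  by (rule K_free_hom[OF assms(1), of "inv_into (pverts G) h"])
    (use assms(2,3) in \<open>force simp: graph_image_def\<close>)+

text \<open>The left summand receives the embedded copy of \<open>V\<close> under its original
  names; the right summand has room to number the finitely many remaining vertices.\<close>

lemma ex_relocation:
  fixes e :: "'a \<Rightarrow> 'b"
  assumes "finite W" "inj_on e V" "e ` V \<subseteq> W"
  obtains h :: "'b \<Rightarrow> 'a + nat" where "inj_on h W" "\<And>a. a \<in> V \<Longrightarrow> h (e a) = Inl a"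
proof -
  obtain s :: "'b \<Rightarrow> nat" where s: "inj_on s W"
    using finite_imp_inj_to_nat_seg[OF assms(1)] by blast
  define h where "h x = (if x \<in> e ` V then Inl (inv_into V e x) else Inr (s x))" for x
  have "inj_on h W"
    using s by (auto simp: inj_on_def h_def dest: inv_into_injective)
  moreover have "h (e a) = Inl a" if "a \<in> V" for a
    using that assms(2) by (simp add: h_def)
  ultimately show ?thesis
    by (rule that)
qed

lemma induced_subgraph_graph_image:
  assumes "pair_graph A" "pair_graph B" "graph_embedding A e B"
  shows "induced_subgraph (with_proj (graph_image e A)) (with_proj B)"
proof -
  have A: "parcs A \<subseteq> pverts A \<times> pverts A" and B: "parcs B \<subseteq> pverts B \<times> pverts B"
    using assms by (auto simp: pair_graph_iff)
  \<comment> \<open>The embedding reflects arcs as well as preserving them, so the copy of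
    \<open>A\<close> has all arcs of \<open>B\<close> between its vertices and is induced.\<close>
  have arcs: "parcs (graph_image e A) =
      {u \<in> parcs B. fst u \<in> e ` pverts A \<and> snd u \<in> e ` pverts A}"
    using A assms(3) by (force simp: graph_image_def graph_embedding_def)
  moreover have "wf_digraph (with_proj (graph_image e A))" "wf_digraph (with_proj B)"
    using arcs B by (auto simp: wf_digraph_def graph_image_def)
  moreover have "pverts (graph_image e A) = e ` pverts A" "e ` pverts A \<subseteq> pverts B"
    using assms(3) by (auto simp: graph_image_def graph_embedding_def)
  ultimately show ?thesis
    by (auto simp: induced_subgraph_def subgraph_def)
qed

section \<open>Assembly for a finite family of partial isomorphisms\<close>

theorem theorem1:
  fixes m n :: nat
    and A :: "'a pair_pre_digraph"
    and p :: "nat \<Rightarrow> 'a \<rightharpoonup> 'a"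
  assumes "m \<ge> 1" and "n \<ge> 1"
    and "pair_graph A" and "K_free m A"
    and "\<And>i. i \<in> {1..n} \<Longrightarrow> partial_isomorphism A (p i)"
  shows "\<exists>(B :: ('a + nat) pair_pre_digraph) (f :: nat \<Rightarrow> 'a + nat \<Rightarrow> 'a + nat).
           pair_graph B \<and> K_free m B \<and>
           induced_subgraph (with_proj (graph_image Inl A)) (with_proj B) \<and>
           (\<forall>i\<in>{1..n}. graph_automorphism B (f i) \<and>
              (\<forall>a b. p i a = Some b \<longrightarrow> f i (Inl a) = Inl b))"
proof -
  obtain B\<^sub>0 :: "('a \<times> 'a set) pair_pre_digraph" and e\<^sub>0 where "extension_witness A e\<^sub>0 B\<^sub>0"
    using ex_extension_witness[OF assms(3)] by blast
  then obtain C :: "(('a \<times> 'a set) \<times> (('a \<times> 'a set) set \<Rightarrow> nat)) pair_pre_digraph" and e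
    where C: "extension_witness A e C" "K_free m C"
    using K_free_extension_witness[OF assms(1,3,4)] by blast
  then have "finite (pverts C)" "parcs C \<subseteq> pverts C \<times> pverts C"
    "inj_on e (pverts A)" "e ` pverts A \<subseteq> pverts C"
    by (auto simp: extension_witness_def graph_embedding_def pair_graph_iff)
  then obtain h :: "_ \<Rightarrow> 'a + nat" where h: "inj_on h (pverts C)"
    and h_e: "\<And>a. a \<in> pverts A \<Longrightarrow> h (e a) = Inl a"
    using ex_relocation by blast
  define B where "B = graph_image h C"
  have B: "extension_witness A (h \<circ> e) B"
    unfolding B_def by (rule extension_witness_relocate[OF C(1) h])
  then have "pair_graph B"
    by (simp add: extension_witness_def)
  moreover have "K_free m B"
    unfolding B_def by (rule K_free_graph_image) fact+
  \<comment> \<open>The maps \<open>h \<circ> e\<close> and \<open>Inl\<close> agree on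
    \<open>pverts A\<close>, and being a \<open>graph_embedding\<close> depends only on the values
    there.\<close>
  moreover have "graph_embedding A Inl B"
    using B h_e by (auto simp: extension_witness_def graph_embedding_def)
  then have "induced_subgraph (with_proj (graph_image Inl A)) (with_proj B)"
    using assms(3) \<open>pair_graph B\<close> by (rule induced_subgraph_graph_image[rotated 2])
  moreover have "\<exists>f. graph_automorphism B f \<and> (\<forall>a b. p i a = Some b \<longrightarrow> f (Inl a) = Inl b)"
    if i: "i \<in> {1..n}" for i
  proof -
    obtain f where f: "graph_automorphism B f"
      "\<And>a b. p i a = Some b \<Longrightarrow> f ((h \<circ> e) a) = (h \<circ> e) b"
      using B assms(5)[OF i] unfolding extension_witness_def by blast
    have "f (Inl a) = Inl b" if ab: "p i a = Some b" for a b
    proof -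
      have "a \<in> pverts A" "b \<in> pverts A"
        using assms(5)[OF i] ab by (auto simp: partial_isomorphism_def dom_def ran_def)
      then show ?thesis
        using f(2)[OF ab] h_e by simp
    qed
    with f(1) show ?thesis by blast
  qed
  then have "\<exists>f. \<forall>i\<in>{1..n}. graph_automorphism B (f i) \<and>
      (\<forall>a b. p i a = Some b \<longrightarrow> f i (Inl a) = Inl b)"
    by (intro bchoice ballI)
  then obtain f where "\<forall>i\<in>{1..n}. graph_automorphism B (f i) \<and>
      (\<forall>a b. p i a = Some b \<longrightarrow> f i (Inl a) = Inl b)"
    by (elim exE)
  ultimately show ?thesis by (intro exI conjI)
qed

end
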